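(* Let $A,B:V\times V\to C$ be two square matrices indexed by a finite set $V$ with entries in a (not necessarily commutative) ring $C$. If $r\ge1$ and $(i,j),(p,q)\in V^2$ satisfy $X^r_{A,2}(i,j)=X^r_{B,2}(p,q)$, then $(A^r)(i,j)=(B^r)(p,q)$.
   Context: For $A:V\times V\to C$, the atomic type $\mathrm{tp}_A(i_1,\dots,i_k)$ of a $k$-tuple is the $k\times k$ array $T$ with $T_{a,b}=(0,A(i_a,i_b))$ if $i_a=i_b$ and $(1,A(i_a,i_b))$ if $i_a\ne i_b$. The $2$-WL colorings are $X^1_{A,2}=\mathrm{tp}_A$ (on pairs) and $X^{r+1}_{A,2}(i,j)=\big(X^r_{A,2}(i,j),\{\!\{(\mathrm{tp}_A(i,j,m),X^r_{A,2}(i,m),X^r_{A,2}(m,j)):m\in V\}\!\}\big)$, where $\{\!\{\cdot\}\!\}$ denotes a multiset. Colors are abstract objects built this way, so colors of $A$ and $B$ can be compared. *)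

theory Defs
  imports Main "HOL-Library.Multiset"
begin

text \<open>A matrix indexed by a finite set \<open>V\<close> is a function \<open>'v \<Rightarrow> 'v \<Rightarrow> 'c\<close> of which only the values
  on \<open>V \<times> V\<close> are used. The class \<^class>\<open>ring\<close> assumes neither commutativity nor a unit (and it
  admits the zero ring, unlike \<^class>\<open>ring_1\<close>).\<close>

definition matrix_prod ::
    "'v set \<Rightarrow> ('v \<Rightarrow> 'v \<Rightarrow> 'c::ring) \<Rightarrow> ('v \<Rightarrow> 'v \<Rightarrow> 'c) \<Rightarrow> 'v \<Rightarrow> 'v \<Rightarrow> 'c"
  where "matrix_prod V A B i j = (\<Sum>m\<in>V. A i m * B m j)"

text \<open>Only positive powers are defined, since the ring need not have a unit; exponent \<open>0\<close> is left
  unspecified.\<close>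

fun matrix_pow :: "'v set \<Rightarrow> ('v \<Rightarrow> 'v \<Rightarrow> 'c::ring) \<Rightarrow> nat \<Rightarrow> 'v \<Rightarrow> 'v \<Rightarrow> 'c"
  where
    "matrix_pow V A (Suc 0) = A"
  | "matrix_pow V A (Suc (Suc r)) = matrix_prod V (matrix_pow V A (Suc r)) A"

text \<open>The atomic type of a \<open>k\<close>-tuple, given as a list of length \<open>k\<close>, is a \<open>k \<times> k\<close> array, given as its
  list of rows.\<close>

type_synonym 'c atomic_type = "(nat \<times> 'c) list list"

definition atp :: "('v \<Rightarrow> 'v \<Rightarrow> 'c) \<Rightarrow> 'v list \<Rightarrow> 'c atomic_type"
  where "atp A is = map (\<lambda>x. map (\<lambda>y. (if x = y then 0 else 1, A x y)) is) is"

text \<open>Colors form a type that mentions neither the matrix nor the index set, so colors of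
  different matrices can be compared.\<close>

datatype 'c wl_color =
    Atomic "'c atomic_type"
  | Refined "'c wl_color" "('c atomic_type \<times> 'c wl_color \<times> 'c wl_color) multiset"

text \<open>Rounds are numbered from \<open>1\<close>; round \<open>0\<close> is left unspecified.\<close>

fun wl2 :: "'v set \<Rightarrow> ('v \<Rightarrow> 'v \<Rightarrow> 'c) \<Rightarrow> nat \<Rightarrow> 'v \<Rightarrow> 'v \<Rightarrow> 'c wl_color"
  where
    "wl2 V A (Suc 0) i j = Atomic (atp A [i, j])"
  | "wl2 V A (Suc (Suc r)) i j =
       Refined (wl2 V A (Suc r) i j)
         {# (atp A [i, j, m], wl2 V A (Suc r) i m, wl2 V A (Suc r) m j). m \<in># mset_set V #}"

end

theory Submission
  imports Defs
begin

text \<open>Induction on \<open>r\<close>. A round-1 color contains the entry at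
  \<open>(i, j)\<close>. If the colors of round \<open>r + 1\<close> agree, their multisets do, so
  the indices \<open>m\<close> and \<open>n\<close> can be matched bijectively with equal triples.
  By the induction hypothesis, matched indices have equal entries of the \<open>r\<close>-th powers
  at \<open>(i, m)\<close> and \<open>(p, n)\<close>; the atomic types give the last factors. So the
  summands of both matrix products form the same multiset.\<close>

text \<open>Equal images under \<open>f\<close> and \<open>g\<close> amount to a pairing of
  \<open>M\<close> with \<open>N\<close> along \<open>f x = g y\<close>; weakening this relation to
  \<open>h x = k y\<close> keeps the pairing.\<close>

lemma image_mset_eq_imp_image_mset_eq:
  assumes "image_mset f M = image_mset g N"
    and "\<And>x y. x \<in># M \<Longrightarrow> y \<in># N \<Longrightarrow> f x = g y \<Longrightarrow> h x = k y"
  shows "image_mset h M = image_mset k N"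
proof -
  have "rel_mset (\<lambda>x y. f x = g y) M N"
    using assms(1) by (simp add: multiset.rel_eq[symmetric] multiset.rel_map)
  then have "rel_mset (\<lambda>x y. h x = k y) M N"
    by (rule multiset.rel_mono_strong) (use assms(2) in blast)
  then show ?thesis
    by (simp add: multiset.rel_eq[symmetric] multiset.rel_map)
qed

theorem theorem3p3:
  fixes V :: "'v set" and A B :: "'v \<Rightarrow> 'v \<Rightarrow> 'c::ring" and r :: nat and i j p q :: 'v
  assumes "finite V"
    and "r \<ge> 1"
    and "i \<in> V" "j \<in> V" "p \<in> V" "q \<in> V"
    and "wl2 V A r i j = wl2 V B r p q"
  shows "matrix_pow V A r i j = matrix_pow V B r p q"
  using assms(2-)
proof (induction r arbitrary: i j p q rule: nat_induct_at_least)
  case base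
  then show ?case
    by (simp add: atp_def)
next
  case (Suc r)
  \<comment> \<open>The recursive equations of \<open>wl2\<close> and \<open>matrix_pow\<close> only
    fire on \<open>Suc (Suc s)\<close>.\<close>
  then obtain s where s: "r = Suc s"
    by (cases r) auto
  have "{# matrix_pow V A r i m * A m j. m \<in># mset_set V #}
      = {# matrix_pow V B r p n * B n q. n \<in># mset_set V #}"
  proof (rule image_mset_eq_imp_image_mset_eq)
    show "{# (atp A [i, j, m], wl2 V A r i m, wl2 V A r m j). m \<in># mset_set V #}
        = {# (atp B [p, q, n], wl2 V B r p n, wl2 V B r n q). n \<in># mset_set V #}"
      using Suc.prems s by simp
  next
    fix m n
    assume "m \<in># mset_set V" "n \<in># mset_set V"
      and eq: "(atp A [i, j, m], wl2 V A r i m, wl2 V A r m j)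
        = (atp B [p, q, n], wl2 V B r p n, wl2 V B r n q)"
    then have "m \<in> V" "n \<in> V"
      using \<open>finite V\<close> by auto
    then have "matrix_pow V A r i m = matrix_pow V B r p n"
      using Suc.IH Suc.prems eq by blast
    \<comment> \<open>This is row 3, column 2 of the atomic types of \<open>[i, j, m]\<close> and
      \<open>[p, q, n]\<close>.\<close>
    moreover have "A m j = B n q"
      using eq by (simp add: atp_def)
    ultimately show "matrix_pow V A r i m * A m j = matrix_pow V B r p n * B n q"
      by simp
  qed
  then show ?case
    by (simp add: s matrix_prod_def sum_unfold_sum_mset)
qed

end
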